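(* Let $r\ge 1$ be an integer. For every integer $n\ge 2$ and for each $\mathrm{O}\in\{\mathrm{Abs},\mathrm{Clr}\}$, $$P^{\mathrm{O}}_{G_{r,n}}(q,1,-1)=(q^r-1)\,P^{\mathrm{O}}_{G_{r,n-1}}(q,1,-1),$$ and $P^{\mathrm{Abs}}_{G_{r,n}}(q,1,-1)=P^{\mathrm{Clr}}_{G_{r,n}}(q,1,-1)$. Consequently, for every $n\ge 1$, $$P^{\mathrm{Abs}}_{G_{r,n}}(q,1,-1)=P^{\mathrm{Clr}}_{G_{r,n}}(q,1,-1)=-\frac{(q^r-1)^n}{q-1}.$$
   Context: For positive integers $r,n$, $G_{r,n}=\mathbb{Z}_r\wr S_n$ is the set of pairs $\sigma=(z,\tau)$ with $z=(z_1,\dots,z_n)\in\{0,\dots,r-1\}^n$ and $\tau\in S_n$, with product $(z,\tau)(z',\tau')=((z_1+z'_{\tau(1)},\dots,z_n+z'_{\tau(n)}),\tau\circ\tau')$ (addition mod $r$). Write $z_i(\sigma)=z_i$ and $|\sigma|=\tau$. Statistics: $\mathrm{exc}(|\sigma|)=\#\{i\in[n]:\tau(i)>i\}$; $\mathrm{csum}(\sigma)=\sum_{i=1}^n z_i(\sigma)$ (sum of the integers $z_i\in\{0,\dots,r-1\}$); $\mathrm{exc}_A(\sigma)=\#\{i\in[n-1]: z_i(\sigma)=0 \text{ and } \tau(i)>i\}$; $\mathrm{cyc}(\sigma)$ = number of cycles of $\tau$; $\mathrm{fix}(\sigma)=\#\{i\in[n]:\tau(i)=i\}$ (absolute fixed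 points). Define $\mathrm{exc}^{\mathrm{Abs}}(\sigma)=\mathrm{exc}(|\sigma|)+\mathrm{csum}(\sigma)$ and $\mathrm{exc}^{\mathrm{Clr}}(\sigma)=r\cdot\mathrm{exc}_A(\sigma)+\mathrm{csum}(\sigma)$. For $\mathrm{O}\in\{\mathrm{Abs},\mathrm{Clr}\}$ and a subset $X\subseteq G_{r,n}$, $P^{\mathrm{O}}_{X}(q,t,s)=\sum_{\sigma\in X}q^{\mathrm{exc}^{\mathrm{O}}(\sigma)}t^{\mathrm{fix}(\sigma)}s^{\mathrm{cyc}(\sigma)}$. *)

theory Defs
  imports
    "HOL-Algebra.Group"
    "HOL-Combinatorics.Orbits"
    "HOL-Computational_Algebra.Polynomial_Factorial"
begin

text \<open>
  An element \<open>(z, \<tau>)\<close> consists of a color vector \<open>z\<close>, indexed by \<open>{1..n}\<close> and \<open>undefined\<close>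
  outside it, and a permutation \<open>\<tau>\<close> that is the identity outside \<open>{1..n}\<close>; elements of
  \<open>G r n\<close> thus have unique representatives.

  The product is \<open>(z, \<tau>)(z', \<tau>') = ((z\<^sub>i + z'\<^bsub>\<tau>(i)\<^esub>)\<^sub>i, \<tau>\<tau>')\<close>, where \<open>\<tau>\<tau>'\<close> means first \<open>\<tau>\<close>, then \<open>\<tau>'\<close>:
  with the opposite composition order, the index \<open>\<tau>(i)\<close> would make the product
  non-associative. Only the carrier matters for the enumerative statements.
\<close>

type_synonym colored_perm = "(nat \<Rightarrow> nat) \<times> (nat \<Rightarrow> nat)"

definition G :: "nat \<Rightarrow> nat \<Rightarrow> colored_perm monoid" where
  "G r n = \<lparr>carrier = ({1..n} \<rightarrow>\<^sub>E {0..<r}) \<times> {\<tau>. \<tau> permutes {1..n}},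
            monoid.mult = (\<lambda>(z, \<tau>) (z', \<tau>'). (\<lambda>i\<in>{1..n}. (z i + z' (\<tau> i)) mod r, \<tau>' \<circ> \<tau>)),
            one = (\<lambda>i\<in>{1..n}. 0, id)\<rparr>"

lemma group_G:
  assumes "r \<ge> 1"
  shows "group (G r n)"
proof (rule groupI)
  fix x y assume "x \<in> carrier (G r n)" "y \<in> carrier (G r n)"
  then show "x \<otimes>\<^bsub>G r n\<^esub> y \<in> carrier (G r n)"
    using assms by (auto simp: G_def intro: permutes_compose)
next
  show "\<one>\<^bsub>G r n\<^esub> \<in> carrier (G r n)"
    using assms by (auto simp: G_def permutes_id)
next
  fix x y w assume A: "x \<in> carrier (G r n)" "y \<in> carrier (G r n)" "w \<in> carrier (G r n)"
  obtain a s b t c u where e: "x = (a, s)" "y = (b, t)" "w = (c, u)"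
    by (metis surj_pair)
  have s: "s i \<in> {1..n}" if "i \<in> {1..n}" for i
    using A that by (simp add: e G_def permutes_in_image del: atLeastAtMost_iff)
  show "x \<otimes>\<^bsub>G r n\<^esub> y \<otimes>\<^bsub>G r n\<^esub> w = x \<otimes>\<^bsub>G r n\<^esub> (y \<otimes>\<^bsub>G r n\<^esub> w)"
    using s by (auto simp: e G_def o_assoc mod_simps add.assoc intro!: restrict_ext)
next
  fix x assume A: "x \<in> carrier (G r n)"
  obtain a s where e: "x = (a, s)" by (metis surj_pair)
  have "(\<lambda>i\<in>{1..n}. a i mod r) = a"
  proof (rule ext)
    fix i show "(\<lambda>i\<in>{1..n}. a i mod r) i = a i"
      using A by (cases "i \<in> {1..n}") (auto simp: e G_def PiE_def Pi_def extensional_def)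
  qed
  moreover have "(\<lambda>i\<in>{1..n}. ((\<lambda>i\<in>{1..n}. 0) i + a i) mod r) = (\<lambda>i\<in>{1..n}. a i mod r)"
    by (intro restrict_ext) simp
  ultimately show "\<one>\<^bsub>G r n\<^esub> \<otimes>\<^bsub>G r n\<^esub> x = x"
    by (simp add: e G_def)
next
  fix x assume A: "x \<in> carrier (G r n)"
  obtain a s where e: "x = (a, s)" by (metis surj_pair)
  have s: "s permutes {1..n}" and a: "a \<in> {1..n} \<rightarrow>\<^sub>E {0..<r}" using A by (auto simp: e G_def)
  define t where "t = Hilbert_Choice.inv s"
  have t: "t permutes {1..n}" unfolding t_def by (rule permutes_inv[OF s])
  have ti: "t i \<in> {1..n}" if "i \<in> {1..n}" for i
    using that by (simp only: permutes_in_image[OF t])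
  define b where "b = (\<lambda>i\<in>{1..n}. (r - a (t i)) mod r)"
  have b: "b \<in> {1..n} \<rightarrow>\<^sub>E {0..<r}" using assms by (auto simp: b_def)
  have "((r - a (t i)) mod r + a (t i)) mod r = 0" if "i \<in> {1..n}" for i
  proof -
    have "a (t i) < r" using PiE_mem[OF a ti[OF that]] by simp
    then show ?thesis by (simp add: mod_simps)
  qed
  then have "(\<lambda>i\<in>{1..n}. (b i + a (t i)) mod r) = (\<lambda>i\<in>{1..n}. 0)"
    by (intro restrict_ext) (simp add: b_def)
  moreover have "s \<circ> t = id" unfolding t_def by (rule permutes_inv_o(1)[OF s])
  ultimately have "(b, t) \<otimes>\<^bsub>G r n\<^esub> x = \<one>\<^bsub>G r n\<^esub>" by (simp add: e G_def)
  moreover have "(b, t) \<in> carrier (G r n)" using b t by (simp add: G_def)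
  ultimately show "\<exists>y\<in>carrier (G r n). y \<otimes>\<^bsub>G r n\<^esub> x = \<one>\<^bsub>G r n\<^esub>" by blast
qed

definition color :: "colored_perm \<Rightarrow> nat \<Rightarrow> nat" where
  "color \<sigma> i = fst \<sigma> i"

definition abs_perm :: "colored_perm \<Rightarrow> nat \<Rightarrow> nat" where
  "abs_perm \<sigma> = snd \<sigma>"

definition exc :: "nat \<Rightarrow> (nat \<Rightarrow> nat) \<Rightarrow> nat" where
  "exc n \<tau> = card {i \<in> {1..n}. \<tau> i > i}"

definition csum :: "nat \<Rightarrow> colored_perm \<Rightarrow> nat" where
  "csum n \<sigma> = (\<Sum>i = 1..n. color \<sigma> i)"

definition exc_A :: "nat \<Rightarrow> colored_perm \<Rightarrow> nat" where
  "exc_A n \<sigma> = card {i \<in> {1..n - 1}. color \<sigma> i = 0 \<and> abs_perm \<sigma> i > i}"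

text \<open>Each cycle, including the trivial ones at fixed points, is counted through its support.\<close>

definition cyc :: "nat \<Rightarrow> colored_perm \<Rightarrow> nat" where
  "cyc n \<sigma> = card (orbit (abs_perm \<sigma>) ` {1..n})"

definition fix_abs :: "nat \<Rightarrow> colored_perm \<Rightarrow> nat" where
  "fix_abs n \<sigma> = card {i \<in> {1..n}. abs_perm \<sigma> i = i}"

datatype exc_kind = Abs | Clr

fun exc_stat :: "exc_kind \<Rightarrow> nat \<Rightarrow> nat \<Rightarrow> colored_perm \<Rightarrow> nat" where
  "exc_stat Abs r n \<sigma> = exc n (abs_perm \<sigma>) + csum n \<sigma>"
| "exc_stat Clr r n \<sigma> = r * exc_A n \<sigma> + csum n \<sigma>"

text \<open>
  The values \<open>q\<close>, \<open>t\<close>, \<open>s\<close> may be taken in any commutative ring, in particular as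
  indeterminates of a polynomial ring. The parameters \<open>r\<close> and \<open>n\<close> are those of the group
  \<open>G r n\<close> that contains \<open>X\<close>.
\<close>

definition P :: "exc_kind \<Rightarrow> nat \<Rightarrow> nat \<Rightarrow> colored_perm set \<Rightarrow> 'a \<Rightarrow> 'a \<Rightarrow> 'a \<Rightarrow> 'a::comm_ring_1" where
  "P K r n X q t s = (\<Sum>\<sigma>\<in>X. q ^ exc_stat K r n \<sigma> * t ^ fix_abs n \<sigma> * s ^ cyc n \<sigma>)"

end

theory Submission
  imports Defs
begin

text \<open>
  For a fixed underlying permutation \<open>\<tau>\<close>, summing over the colors gives
  \<open>q ^ exc \<tau> * (1 + q + \<dots> + q ^ (r - 1)) ^ n\<close> for both statistics: in the \<open>Clr\<close> case an excedance
  contributes \<open>q ^ r + q + \<dots> + q ^ (r - 1) = q * (1 + q + \<dots> + q ^ (r - 1))\<close>.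
  Since \<open>(-1) ^ cyc \<tau> = (-1) ^ n * sign \<tau>\<close>, it remains to evaluate \<open>\<Sum>\<tau>. sign \<tau> * q ^ exc \<tau>\<close>.
  Swapping the values of \<open>\<tau>\<close> at \<open>n\<close> and \<open>n + 1\<close> reverses the sign, and preserves the number
  of excedances unless one of these values is \<open>n + 1\<close>; the surviving terms give the factor
  \<open>1 - q\<close> from \<open>n\<close> to \<open>n + 1\<close>.
\<close>

section \<open>Parity of the number of cycles and the sign of a permutation\<close>

text \<open>Composing with the transposition bypasses \<open>a\<close>: a point that
  \<open>f\<close> sends to \<open>a\<close> now goes straight to \<open>f a\<close>,
  \<open>a\<close> itself becomes fixed, and nothing else changes.\<close>

lemma orbit_transpose_comp:
  assumes f: "inj f" and a: "f a \<noteq> a" and x: "x \<noteq> a"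
  shows "orbit (transpose a (f a) \<circ> f) x = orbit f x - {a}" (is "orbit ?g x = _")
proof (intro Set.set_eqI iffI)
  have g: "?g y = (if f y = a then f a else f y)" if "y \<noteq> a" for y
    using f that by (auto simp: transpose_def inj_eq)
  {
    fix y assume "y \<in> orbit ?g x"
    then show "y \<in> orbit f x - {a}"
    proof induction
      case base
      show ?case unfolding g[OF x] using a by (auto intro: orbit.intros)
    next
      case (step y)
      then have y: "y \<noteq> a" "y \<in> orbit f x" by auto
      show ?case unfolding g[OF y(1)] using a y(2) by (auto intro: orbit.intros)
    qed
  next
    fix y assume "y \<in> orbit f x - {a}"
    \<comment> \<open>Strengthened for the induction: when the orbit of \<open>f\<close> passes
      through \<open>a\<close>, which the new map skips, the successor \<open>f a\<close> stands in
      for it.\<close>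
    moreover have "(if y = a then f a else y) \<in> orbit ?g x" if "y \<in> orbit f x" for y
      using that
    proof induction
      case base
      have "?g x \<in> orbit ?g x" by (rule orbit.base)
      then show ?case unfolding g[OF x] .
    next
      case (step y)
      show ?case
      proof (cases "y = a")
        case True
        then show ?thesis using step.IH a by simp
      next
        case False
        then have "?g y \<in> orbit ?g x" using step.IH by (intro orbit.step) simp
        then show ?thesis unfolding g[OF False] .
      qed
    qed
    ultimately show "y \<in> orbit ?g x" by (metis DiffE singletonI)
  }
qed

lemma orbit_eqI_mem:
  assumes "permutation f" "x \<in> orbit f y"
  shows "orbit f x = orbit f y"
  using orbit_cyclic_eq3[OF cyclic_on_orbit'[OF assms(1)] assms(2)] .

text \<open>Induction by removing a point \<open>a\<close> from its cycle. If \<open>a\<close> is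
  fixed, both the number of orbits and the size of the set drop by one and the sign stays. Otherwise
  the number of orbits stays, while the size drops by one and the sign flips.\<close>

lemma minus_one_power_card_orbits:
  assumes "finite S" "f permutes S"
  shows "(- 1 :: int) ^ card (orbit f ` S) = (- 1) ^ card S * sign f"
  using assms
proof (induction S arbitrary: f rule: finite_induct)
  case empty
  then show ?case by simp
next
  case (insert a S)
  have perm: "permutation f"
    using insert.prems insert.hyps(1) by (meson finite.insertI permutation_permutes)
  show ?case
  proof (cases "f a = a")
    case True
    have f: "f permutes S"
      using True by (intro permutes_superset[OF insert.prems]) auto
    have "orbit f a = {a}"
      using True by (simp add: orbit_eq_singleton_iff)
    moreover have "a \<notin> orbit f x" if "x \<in> S" for x
      using permutes_orbit_subset[OF f that] insert.hyps(2) by blast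
    ultimately have "orbit f a \<notin> orbit f ` S"
      by (metis imageE insertI1)
    then show ?thesis
      using insert.IH[OF f] insert.hyps by simp
  next
    case False
    define g where "g = transpose a (f a) \<circ> f"
    have g: "g permutes S"
      unfolding g_def by (rule permutes_insert_lemma[OF insert.prems])
    have "f = transpose a (f a) \<circ> g"
      by (simp add: g_def fun_eq_iff)
    moreover have "permutation g"
      using g insert.hyps(1) permutation_permutes by blast
    ultimately have sign: "sign f = - sign g"
      using False by (metis mult_minus1 permutation_swap_id sign_compose sign_swap_id)
    have "f a \<in> S"
      using insert.prems False by (metis insertE insertI1 permutes_in_image)
    \<comment> \<open>The cycle of \<open>a\<close> is already represented by \<open>f a\<close>, so
      \<open>a\<close> adds no orbit.\<close>
    then have "orbit f a \<in> orbit f ` S"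
      by (metis image_eqI perm permutation_orbit_step)
    then have f_orbits: "orbit f ` insert a S = orbit f ` S"
      by auto
    have "orbit g x = orbit f x - {a}" if "x \<in> S" for x
      unfolding g_def
      using that insert.hyps(2) False by (intro orbit_transpose_comp permutes_inj[OF insert.prems]) auto
    then have "orbit g ` S = (\<lambda>C. C - {a}) ` orbit f ` S"
      by (auto simp: image_image)
    \<comment> \<open>Each of these orbits keeps a point of \<open>S\<close> after \<open>a\<close>
      is deleted, and one common point makes two orbits equal.\<close>
    moreover have "inj_on (\<lambda>C. C - {a}) (orbit f ` S)"
    proof (rule inj_onI, clarify)
      fix x y assume xy: "x \<in> S" "y \<in> S" "orbit f x - {a} = orbit f y - {a}"
      have "x \<in> orbit f x - {a}"
        using xy(1) insert.hyps(2) permutation_self_in_orbit[OF perm] by auto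
      then show "orbit f x = orbit f y"
        using xy(3) by (intro orbit_eqI_mem[OF perm]) auto
    qed
    ultimately have "card (orbit g ` S) = card (orbit f ` insert a S)"
      by (simp only: f_orbits card_image)
    then show ?thesis
      using insert.IH[OF g] insert.hyps sign by simp
  qed
qed

section \<open>Signed enumeration of permutations by excedances\<close>

lemma exc_permutes:
  assumes "\<tau> permutes {1..n}" "n \<le> m"
  shows "exc m \<tau> = exc n \<tau>"
proof -
  have "\<tau> i = i" if "i > n" for i
    using assms(1) that by (simp add: permutes_def)
  then have "{i \<in> {1..m}. \<tau> i > i} = {i \<in> {1..n}. \<tau> i > i}"
    using assms(2) by (auto simp: not_less[symmetric])
  then show ?thesis by (simp add: exc_def)
qed

lemma exc_Suc:
  "exc (Suc n) \<tau> = exc n \<tau> + (if \<tau> (Suc n) > Suc n then 1 else 0)"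
proof -
  have "{i \<in> {1..Suc n}. \<tau> i > i} =
        (if \<tau> (Suc n) > Suc n then insert (Suc n) {i \<in> {1..n}. \<tau> i > i} else {i \<in> {1..n}. \<tau> i > i})"
    by (auto simp: le_Suc_eq)
  then show ?thesis by (simp add: exc_def)
qed

text \<open>Only the last two positions can change status. The last one is never an excedance, and
  the one before it is an excedance exactly when its value is the maximum.\<close>

lemma exc_comp_transpose:
  assumes \<tau>: "\<tau> permutes {1..Suc (Suc n)}" and "\<tau> (Suc n) \<noteq> Suc (Suc n)"
  shows "exc (Suc (Suc n)) (\<tau> \<circ> transpose (Suc n) (Suc (Suc n))) =
         exc (Suc (Suc n)) \<tau> + (if \<tau> (Suc (Suc n)) = Suc (Suc n) then 1 else 0)"
proof -
  have bound: "\<tau> i \<le> Suc (Suc n)" if "1 \<le> i" "i \<le> Suc (Suc n)" for i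
    using permutes_in_image[OF \<tau>, of i] that by simp
  have "exc n (\<tau> \<circ> transpose (Suc n) (Suc (Suc n))) = exc n \<tau>"
    unfolding exc_def by (rule arg_cong[where f = card]) (auto simp: transpose_def)
  then show ?thesis
    using bound[of "Suc n"] bound[of "Suc (Suc n)"] assms(2)
    by (auto simp: exc_Suc)
qed

text \<open>The recursion starts at size 1: the swap needs two positions, and \<open>D 0\<close> and
  \<open>D 1\<close> are both 1.\<close>

lemma signed_exc_sum_Suc:
  fixes q :: "'a :: {idom, ring_char_0}"
  defines "D \<equiv> \<lambda>n. \<Sum>\<tau> | \<tau> permutes {1..n}. of_int (sign \<tau>) * q ^ exc n \<tau>"
  shows "D (Suc (Suc n)) = (1 - q) * D (Suc n)"
proof -
  define m where "m = Suc (Suc n)"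
  define s where "s = transpose (Suc n) m"
  define w where "w = (\<lambda>\<tau>. of_int (sign \<tau>) * q ^ exc m \<tau>)"
  \<comment> \<open>The classes record the preimage of the maximum \<open>m\<close>: it is
    \<open>m\<close>, \<open>Suc n\<close>, or a smaller point. Composition with \<open>s\<close>
    exchanges \<open>F\<close> and \<open>H\<close> and preserves \<open>R\<close>.\<close>
  define F where "F = {\<tau>. \<tau> permutes {1..m} \<and> \<tau> m = m}"
  define H where "H = {\<tau>. \<tau> permutes {1..m} \<and> \<tau> (Suc n) = m}"
  define R where "R = {\<tau>. \<tau> permutes {1..m} \<and> \<tau> m \<noteq> m \<and> \<tau> (Suc n) \<noteq> m}"
  have s: "s permutes {1..m}"
    unfolding s_def by (rule permutes_swap_id) (auto simp: m_def)
  have s_simps: "s m = Suc n" "s (Suc n) = m" "s \<circ> s = id"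
    by (auto simp: s_def)
  have s_invol: "\<tau> \<circ> s \<circ> s = \<tau>" for \<tau> :: "nat \<Rightarrow> nat"
    by (simp add: comp_assoc s_simps)
  have sign_s: "sign (\<tau> \<circ> s) = - sign \<tau>" if "\<tau> permutes {1..m}" for \<tau>
  proof -
    have "sign (\<tau> \<circ> s) = sign \<tau> * sign s"
      using that s by (intro sign_compose) (auto simp: permutation_permutes)
    then show ?thesis by (simp add: s_def sign_swap_id m_def)
  qed
  have split: "{\<tau>. \<tau> permutes {1..m}} = F \<union> H \<union> R"
    by (auto simp: F_def H_def R_def)
  have fin: "finite F" "finite H" "finite R"
    using finite_permutations[of "{1..m}"] by (auto simp: F_def H_def R_def)
  have "\<tau> (Suc n) \<noteq> \<tau> m" if "\<tau> permutes {1..m}" for \<tau>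
    using permutes_inj[OF that] by (simp add: inj_eq m_def)
  then have disj: "F \<inter> H = {}" "(F \<union> H) \<inter> R = {}"
    unfolding F_def H_def R_def by (metis (mono_tags, lifting) disjoint_iff mem_Collect_eq, blast)
  have D_m: "D m = sum w F + sum w H + sum w R"
    unfolding D_def split w_def using fin disj by (simp add: sum.union_disjoint)

  have F_eq: "F = {\<tau>. \<tau> permutes {1..Suc n}}"
  proof (intro Set.set_eqI iffI)
    fix \<tau> assume "\<tau> \<in> F"
    then have "\<tau> permutes {1..m}" "\<tau> m = m" by (auto simp: F_def)
    then show "\<tau> \<in> {\<tau>. \<tau> permutes {1..Suc n}}"
      unfolding mem_Collect_eq by (elim permutes_superset) (auto simp: m_def le_Suc_eq)
  next
    fix \<tau> assume "\<tau> \<in> {\<tau>. \<tau> permutes {1..Suc n}}"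
    then have \<tau>: "\<tau> permutes {1..Suc n}" by simp
    then have "\<tau> permutes {1..m}" by (rule permutes_subset) (auto simp: m_def)
    moreover have "\<tau> m = m" using \<tau> by (simp add: permutes_def m_def)
    ultimately show "\<tau> \<in> F" by (simp add: F_def)
  qed
  have sum_F: "sum w F = D (Suc n)"
    unfolding F_eq D_def w_def by (intro sum.cong refl) (use exc_permutes[of _ "Suc n" m] in \<open>simp add: m_def\<close>)

  \<comment> \<open>Passing from \<open>F\<close> to \<open>H\<close> creates one excedance, at
    \<open>Suc n\<close>, and flips the sign; hence the factor \<open>- q\<close>.\<close>
  have sum_H: "sum w H = - q * sum w F"
  proof -
    have "sum w H = (\<Sum>\<tau>\<in>F. w (\<tau> \<circ> s))"
      by (rule sum.reindex_bij_witness[of _ "\<lambda>\<tau>. \<tau> \<circ> s" "\<lambda>\<tau>. \<tau> \<circ> s"])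
        (simp_all add: s_invol F_def H_def s_simps permutes_compose[OF s] del: One_nat_def)
    also have "\<dots> = (\<Sum>\<tau>\<in>F. - q * w \<tau>)"
    proof (rule sum.cong[OF refl])
      fix \<tau> assume "\<tau> \<in> F"
      then have \<tau>: "\<tau> permutes {1..m}" "\<tau> m = m" by (auto simp: F_def)
      then have "\<tau> (Suc n) \<noteq> m"
        using permutes_inj[OF \<tau>(1)] by (metis injD m_def n_not_Suc_n)
      then have "exc m (\<tau> \<circ> s) = exc m \<tau> + 1"
        using exc_comp_transpose[of \<tau> n] \<tau> by (simp add: s_def m_def)
      then show "w (\<tau> \<circ> s) = - q * w \<tau>"
        by (simp add: w_def sign_s[OF \<tau>(1)])
    qed
    finally show ?thesis by (simp add: sum_distrib_left)
  qed

  have "sum w R = (\<Sum>\<tau>\<in>R. w (\<tau> \<circ> s))"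
    by (rule sum.reindex_bij_witness[of _ "\<lambda>\<tau>. \<tau> \<circ> s" "\<lambda>\<tau>. \<tau> \<circ> s"])
      (simp_all add: s_invol R_def s_simps permutes_compose[OF s] del: One_nat_def)
  also have "\<dots> = (\<Sum>\<tau>\<in>R. - w \<tau>)"
  proof (rule sum.cong[OF refl])
    fix \<tau> assume "\<tau> \<in> R"
    then have \<tau>: "\<tau> permutes {1..m}" "\<tau> m \<noteq> m" "\<tau> (Suc n) \<noteq> m" by (auto simp: R_def)
    then have "exc m (\<tau> \<circ> s) = exc m \<tau>"
      using exc_comp_transpose[of \<tau> n] by (simp add: s_def m_def)
    then show "w (\<tau> \<circ> s) = - w \<tau>"
      by (simp add: w_def sign_s[OF \<tau>(1)])
  qed
  \<comment> \<open>The sum equals its own negative, hence vanishes in an integral domain of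
    characteristic zero.\<close>
  finally have sum_R: "sum w R = 0"
    by (simp add: sum_negf)
  show ?thesis
    using D_m by (simp add: sum_R sum_H sum_F m_def algebra_simps)
qed

lemma signed_exc_sum:
  fixes q :: "'a :: {idom, ring_char_0}"
  shows "(\<Sum>\<tau> | \<tau> permutes {1..Suc n}. of_int (sign \<tau>) * q ^ exc (Suc n) \<tau>) = (1 - q) ^ n"
proof (induction n)
  case 0
  have "{\<tau>. \<tau> permutes {1..Suc 0}} = {id}" by simp
  then show ?case by (simp add: exc_def)
next
  case (Suc n)
  then show ?case by (simp only: signed_exc_sum_Suc power_Suc)
qed

text \<open>The size of the set contributes \<open>(- 1) ^ Suc n\<close>: \<open>n\<close> of these
  signs turn \<open>1 - q\<close> into \<open>q - 1\<close>, and the last one stays in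
  front.\<close>

lemma exc_cyc_sum:
  fixes q :: "'a :: {idom, ring_char_0}"
  shows "(\<Sum>\<tau> | \<tau> permutes {1..Suc n}. q ^ exc (Suc n) \<tau> * (- 1) ^ card (orbit \<tau> ` {1..Suc n})) =
         - ((q - 1) ^ n)"
proof -
  have "(- 1 :: 'a) ^ card (orbit \<tau> ` {1..Suc n}) = (- 1) ^ Suc n * of_int (sign \<tau>)"
    if "\<tau> permutes {1..Suc n}" for \<tau>
    using arg_cong[OF minus_one_power_card_orbits[OF _ that], of "of_int :: int \<Rightarrow> 'a"] by simp
  then have "(\<Sum>\<tau> | \<tau> permutes {1..Suc n}. q ^ exc (Suc n) \<tau> * (- 1) ^ card (orbit \<tau> ` {1..Suc n})) =
      (- 1) ^ Suc n * (\<Sum>\<tau> | \<tau> permutes {1..Suc n}. of_int (sign \<tau>) * q ^ exc (Suc n) \<tau>)"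
    unfolding sum_distrib_left by (intro sum.cong) (auto simp: mult_ac)
  also have "\<dots> = - ((- 1) ^ n * (1 - q) ^ n)"
    by (simp only: signed_exc_sum) simp
  also have "\<dots> = - ((q - 1) ^ n)"
    by (simp flip: power_mult_distrib)
  finally show ?thesis .
qed

section \<open>Summation over the color vectors\<close>

lemma color_sum_Abs:
  fixes q :: "'a :: comm_ring_1"
  shows "(\<Sum>z\<in>{1..n} \<rightarrow>\<^sub>E {0..<r}. q ^ exc_stat Abs r n (z, \<tau>)) = q ^ exc n \<tau> * (\<Sum>j<r. q ^ j) ^ n"
proof -
  have "(\<Sum>z\<in>{1..n} \<rightarrow>\<^sub>E {0..<r}. q ^ exc_stat Abs r n (z, \<tau>)) =
        q ^ exc n \<tau> * (\<Sum>z\<in>{1..n} \<rightarrow>\<^sub>E {0..<r}. \<Prod>i=1..n. q ^ z i)"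
    by (simp add: csum_def color_def abs_perm_def power_add power_sum sum_distrib_left)
  also have "(\<Sum>z\<in>{1..n} \<rightarrow>\<^sub>E {0..<r}. \<Prod>i=1..n. q ^ z i) = (\<Prod>i=1..n. \<Sum>j\<in>{0..<r}. q ^ j)"
    by (rule prod_sum_PiE[symmetric]) auto
  finally show ?thesis by (simp add: atLeast0LessThan)
qed

lemma color_sum_Clr:
  fixes q :: "'a :: comm_ring_1"
  assumes r: "r \<ge> 1" and \<tau>: "\<tau> permutes {1..n}"
  shows "(\<Sum>z\<in>{1..n} \<rightarrow>\<^sub>E {0..<r}. q ^ exc_stat Clr r n (z, \<tau>)) = q ^ exc n \<tau> * (\<Sum>j<r. q ^ j) ^ n"
proof -
  \<comment> \<open>The contribution of position \<open>i\<close> with color \<open>j\<close> to the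
    \<open>Clr\<close> statistic. At an excedance the contributions run over 1 to \<open>r\<close>
    instead of 0 to \<open>r - 1\<close>.\<close>
  define b where "b = (\<lambda>i j. if j = 0 \<and> \<tau> i > i then r else j)"
  have bound: "\<tau> i \<le> n" if "i \<in> {1..n}" for i
    using permutes_in_image[OF \<tau>, of i] that by simp
  have stat: "exc_stat Clr r n (z, \<tau>) = (\<Sum>i=1..n. b i (z i))" for z
  proof -
    \<comment> \<open>Position \<open>n\<close> may be included, since its value is at most
      \<open>n\<close>.\<close>
    have "{i \<in> {1..n - 1}. z i = 0 \<and> \<tau> i > i} = {i \<in> {1..n}. z i = 0 \<and> \<tau> i > i}"
      using bound by fastforce
    then have "exc_stat Clr r n (z, \<tau>) =
        (\<Sum>i=1..n. if z i = 0 \<and> \<tau> i > i then r else 0) + (\<Sum>i=1..n. z i)"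
      by (simp add: exc_A_def csum_def color_def abs_perm_def sum.If_cases Int_def)
    also have "\<dots> = (\<Sum>i=1..n. b i (z i))"
      unfolding sum.distrib[symmetric] by (intro sum.cong) (auto simp: b_def)
    finally show ?thesis .
  qed
  have "(\<Sum>j<r. q ^ b i j) = (if \<tau> i > i then q else 1) * (\<Sum>j<r. q ^ j)" for i
  proof (cases "\<tau> i > i")
    case True
    obtain k where k: "r = Suc k" using r by (cases r) auto
    \<comment> \<open>Color 0 is split off; its exponent \<open>r\<close> then serves as the top
      term of a geometric sum shifted by one.\<close>
    have "(\<Sum>j<r. q ^ b i j) = q ^ r + (\<Sum>j<k. q ^ Suc j)"
      using True unfolding k by (simp only: sum.lessThan_Suc_shift) (simp add: b_def k)
    also have "\<dots> = (\<Sum>j<r. q ^ Suc j)"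
      by (simp add: k)
    finally show ?thesis using True by (simp add: sum_distrib_left)
  next
    case False
    then show ?thesis by (simp add: b_def)
  qed
  then have "(\<Prod>i=1..n. \<Sum>j<r. q ^ b i j) = q ^ exc n \<tau> * (\<Sum>j<r. q ^ j) ^ n"
    by (simp add: prod.distrib prod.If_cases exc_def Int_def)
  moreover have "(\<Sum>z\<in>{1..n} \<rightarrow>\<^sub>E {0..<r}. q ^ exc_stat Clr r n (z, \<tau>)) = (\<Prod>i=1..n. \<Sum>j<r. q ^ b i j)"
    unfolding stat power_sum atLeast0LessThan by (rule prod_sum_PiE[symmetric]) auto
  ultimately show ?thesis by simp
qed

section \<open>Evaluation of the generating polynomials\<close>

text \<open>A division-free closed form: each geometric sum stands for the quotient of
  \<open>q ^ r - 1\<close> by \<open>q - 1\<close>. As the value does not depend on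
  \<open>K\<close>, the two statistics agree.\<close>

lemma P_carrier_G:
  fixes q :: "'a :: {idom, ring_char_0}"
  assumes "r \<ge> 1"
  shows "P K r (Suc n) (carrier (G r (Suc n))) q 1 (- 1) = - ((\<Sum>j<r. q ^ j) ^ Suc n * (q - 1) ^ n)"
proof -
  let ?Z = "{1..Suc n} \<rightarrow>\<^sub>E {0..<r}" and ?T = "{\<tau>. \<tau> permutes {1..Suc n}}"
  have "P K r (Suc n) (carrier (G r (Suc n))) q 1 (- 1) =
        (\<Sum>z\<in>?Z. \<Sum>\<tau>\<in>?T. q ^ exc_stat K r (Suc n) (z, \<tau>) * (- 1) ^ card (orbit \<tau> ` {1..Suc n}))"
    unfolding sum.cartesian_product
    by (auto simp: P_def G_def cyc_def abs_perm_def intro!: sum.cong)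
  also have "\<dots> =
      (\<Sum>\<tau>\<in>?T. (\<Sum>z\<in>?Z. q ^ exc_stat K r (Suc n) (z, \<tau>)) * (- 1) ^ card (orbit \<tau> ` {1..Suc n}))"
    unfolding sum_distrib_right by (rule sum.swap)
  also have "\<dots> = (\<Sum>\<tau>\<in>?T. (\<Sum>j<r. q ^ j) ^ Suc n *
      (q ^ exc (Suc n) \<tau> * (- 1) ^ card (orbit \<tau> ` {1..Suc n})))"
  proof (rule sum.cong[OF refl])
    fix \<tau> assume "\<tau> \<in> ?T"
    then have "(\<Sum>z\<in>?Z. q ^ exc_stat K r (Suc n) (z, \<tau>)) = q ^ exc (Suc n) \<tau> * (\<Sum>j<r. q ^ j) ^ Suc n"
      by (cases K) (simp_all only: color_sum_Abs color_sum_Clr[OF assms] mem_Collect_eq)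
    then show "(\<Sum>z\<in>?Z. q ^ exc_stat K r (Suc n) (z, \<tau>)) * (- 1) ^ card (orbit \<tau> ` {1..Suc n}) =
        (\<Sum>j<r. q ^ j) ^ Suc n * (q ^ exc (Suc n) \<tau> * (- 1) ^ card (orbit \<tau> ` {1..Suc n}))"
      by (simp only: mult_ac)
  qed
  also have "\<dots> = - ((\<Sum>j<r. q ^ j) ^ Suc n * (q - 1) ^ n)"
    by (simp only: sum_distrib_left[symmetric] exc_cyc_sum mult_minus_right)
  finally show ?thesis .
qed

text \<open>Here \<open>q\<close> is the indeterminate over the integers, and
  \<open>to_fract\<close> moves to the fraction field, where division by \<open>q - 1\<close> makes
  sense.\<close>

theorem theorem1:
  fixes r :: nat and q :: "int poly"
  assumes r: "r \<ge> 1"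
    and q: "q = [:0, 1:]"
  shows "(\<forall>n\<ge>2.
            (\<forall>K. P K r n (carrier (G r n)) q 1 (-1)
                   = (q ^ r - 1) * P K r (n - 1) (carrier (G r (n - 1))) q 1 (-1)) \<and>
            P Abs r n (carrier (G r n)) q 1 (-1) = P Clr r n (carrier (G r n)) q 1 (-1)) \<and>
         (\<forall>n\<ge>1.
            P Abs r n (carrier (G r n)) q 1 (-1) = P Clr r n (carrier (G r n)) q 1 (-1) \<and>
            to_fract (P Clr r n (carrier (G r n)) q 1 (-1))
              = - ((to_fract q ^ r - 1) ^ n / (to_fract q - 1)))"
proof -
  have eq: "P Abs r n (carrier (G r n)) q 1 (-1) = P Clr r n (carrier (G r n)) q 1 (-1)"
    if "n \<ge> 1" for n
  proof -
    obtain m where n: "n = Suc m" using \<open>n \<ge> 1\<close> by (cases n) auto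
    show ?thesis unfolding n P_carrier_G[OF r] ..
  qed
  have rec: "P K r n (carrier (G r n)) q 1 (-1)
      = (q ^ r - 1) * P K r (n - 1) (carrier (G r (n - 1))) q 1 (-1)" if "n \<ge> 2" for n K
  proof -
    obtain m where n: "n = Suc (Suc m)"
      using \<open>n \<ge> 2\<close> by (metis One_nat_def Suc_1 Suc_le_D Suc_le_mono)
    show ?thesis
      unfolding n diff_Suc_1 P_carrier_G[OF r] power_diff_1_eq by (simp add: mult_ac)
  qed
  have closed: "to_fract (P Clr r n (carrier (G r n)) q 1 (-1))
      = - ((to_fract q ^ r - 1) ^ n / (to_fract q - 1))" if "n \<ge> 1" for n
  proof -
    obtain m where n: "n = Suc m" using \<open>n \<ge> 1\<close> by (cases n) auto
    have to_fract_power: "to_fract (x ^ k) = to_fract x ^ k" for x :: "int poly" and k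
      by (induction k) simp_all
    \<comment> \<open>The extra factor \<open>q - 1\<close> pairs the last of the \<open>n\<close>
      geometric sums, so the identity already holds between polynomials.\<close>
    have "(q - 1) * P Clr r n (carrier (G r n)) q 1 (-1) = - ((q ^ r - 1) ^ n)"
      unfolding n P_carrier_G[OF r] power_diff_1_eq[of q r] power_mult_distrib
      by (simp add: mult_ac)
    then have "to_fract ((q - 1) * P Clr r n (carrier (G r n)) q 1 (-1)) = to_fract (- ((q ^ r - 1) ^ n))"
      by (rule arg_cong)
    then have "(to_fract q - 1) * to_fract (P Clr r n (carrier (G r n)) q 1 (-1))
        = - ((to_fract q ^ r - 1) ^ n)"
      by (simp only: to_fract_power to_fract_mult to_fract_diff to_fract_uminus to_fract_1)
    moreover have "to_fract q - 1 \<noteq> 0"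
    proof -
      have "q - 1 \<noteq> 0" by (simp add: q one_pCons)
      then have "to_fract (q - 1) \<noteq> 0" by (simp only: to_fract_eq_0_iff) simp
      then show ?thesis by simp
    qed
    ultimately show ?thesis
      unfolding minus_divide_left by (metis nonzero_mult_div_cancel_left)
  qed
  show ?thesis using eq rec closed by (meson le_trans one_le_numeral)
qed

end
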